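(* Let $m\ge1$, $n=2m$, and let $\pi_1,\pi_2,\pi_3$ be permutations of $\mathbb{F}_{2^m}$ having the $(\mathcal{A}_m)$ property. Let $h_1,h_2,h_3,s$ be Boolean functions on $\mathbb{F}_{2^m}$ and for $i\in\{1,2,3\}$ let $f_i(x,y)=Tr(x\pi_i(y))+h_i(y)$, $x,y\in\mathbb{F}_{2^m}$. Define $h_4(y)=h_1(y)+h_2(y)+h_3(y)+s(y)$ and $f_4(x,y)=f_1(x,y)+f_2(x,y)+f_3(x,y)+s(y)$. If for all $x\in\mathbb{F}_{2^m}$ $$h_1(\pi_1^{-1}(x))+h_2(\pi_2^{-1}(x))+h_3(\pi_3^{-1}(x))+h_4\big((\pi_1+\pi_2+\pi_3)^{-1}(x)\big)=1,$$ then the concatenation $f_1\|f_2\|f_3\|f_4$ is a bent function in $n+2$ variables.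
   Context: $Tr\colon\mathbb{F}_{2^m}\to\mathbb{F}_2$, $Tr(x)=\sum_{i=0}^{m-1}x^{2^i}$, is the absolute trace. Three permutations $\pi_1,\pi_2,\pi_3$ of $\mathbb{F}_{2^m}$ have the $(\mathcal{A}_m)$ property if $\pi_4=\pi_1+\pi_2+\pi_3$ is a permutation and $\pi_4^{-1}=\pi_1^{-1}+\pi_2^{-1}+\pi_3^{-1}$. A Boolean function $g$ on $\mathbb{F}_2^N$ ($N$ even) is bent if its Walsh–Hadamard transform $W_g(a)=\sum_{z\in\mathbb{F}_2^N}(-1)^{g(z)+a\cdot z}$ satisfies $W_g(a)=\pm2^{N/2}$ for all $a$. Functions on $\mathbb{F}_{2^m}\times\mathbb{F}_{2^m}$ are identified with functions on $\mathbb{F}_2^n$. For $g_1,\dots,g_4$ on $\mathbb{F}_2^n$, the concatenation $g=g_1\|g_2\|g_3\|g_4$ is the function on $\mathbb{F}_2^{n+2}$ given by $g(z,z_{n+1},z_{n+2})=g_1(z)+z_{n+1}(g_1+g_3)(z)+z_{n+2}(g_1+g_2)(z)+z_{n+1}z_{n+2}(g_1+g_2+g_3+g_4)(z)$; thus $g(z,0,0)=g_1(z)$, $g(z,0,1)=g_2(z)$, $g(z,1,0)=g_3(z)$, $g(z,1,1)=g_4(z)$. *)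

theory Defs
  imports
    "HOL-Library.Cardinality"
    "HOL-Library.Z2"
    "HOL-Library.Product_Plus"
    "HOL-Number_Theory.Residues"
    "Jordan_Normal_Form.Matrix"
begin

text \<open>
  The field with two elements is \<^typ>\<open>bit\<close>, and its \<open>N\<close>-dimensional coordinate space is
  \<^term>\<open>carrier_vec N :: bit vec set\<close>. A finite field type of cardinality \<open>2 ^ m\<close> plays the
  role of the field with \<open>2 ^ m\<close> elements.
\<close>

text \<open>
  The sum of the conjugates lies in the prime field (lemma \<open>of_bit_abs_trace\<close>); the trace is that
  sum read as an element of \<^typ>\<open>bit\<close>.
\<close>

definition abs_trace :: "nat \<Rightarrow> 'a::finite_field \<Rightarrow> bit" where
  "abs_trace m x = (THE b. of_bit b = (\<Sum>i<m. x ^ (2 ^ i)))"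

lemma CHAR_eq_2:
  assumes "CARD('a::finite_field) = 2 ^ m"
  shows "CHAR('a) = 2"
proof -
  have "CHAR('a) dvd 2 ^ m"
    using CHAR_dvd_CARD[where 'a='a] assms by simp
  moreover have "prime CHAR('a)"
    by (rule prime_CHAR_semidom) (simp add: finite_imp_CHAR_pos)
  ultimately show ?thesis
    by (metis prime_dvd_power primes_dvd_imp_eq two_is_prime_nat)
qed

lemma of_bit_abs_trace:
  fixes x :: "'a::finite_field"
  assumes "CARD('a) = 2 ^ m"
  shows "of_bit (abs_trace m x) = (\<Sum>i<m. x ^ (2 ^ i))"
proof -
  define S where "S = (\<Sum>i<m. x ^ (2 ^ i))"
  have "S ^ 2 = (\<Sum>i<m. (x ^ (2 ^ i)) ^ 2)"
    unfolding S_def using freshmans_dream_sum[where 'a='a] CHAR_eq_2[OF assms] two_is_prime_nat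
    by metis
  also have "\<dots> = (\<Sum>i<m. x ^ (2 ^ Suc i))"
    by (simp flip: power_mult add: mult.commute)
  also have "\<dots> = S"
  proof -
    have "x ^ (2 ^ m) = x"
      using finite_field_power_card_eq_same[of x] assms by simp
    then show ?thesis
      using sum.lessThan_Suc_shift[of "\<lambda>i. x ^ (2 ^ i)" m] sum.lessThan_Suc[of "\<lambda>i. x ^ (2 ^ i)" m]
      unfolding S_def by (simp add: algebra_simps)
  qed
  finally have "S * (S - 1) = 0"
    by (simp add: power2_eq_square algebra_simps)
  then have "S = of_bit 0 \<or> S = of_bit 1"
    by simp
  then obtain b where b: "of_bit b = S"
    by metis
  moreover have "c = b" if "of_bit c = S" for c
    using that b by (cases b; cases c) auto
  ultimately have "\<exists>!b. of_bit b = S"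
    by blast
  then show ?thesis
    unfolding abs_trace_def S_def[symmetric] by (rule theI')
qed

text \<open>The inverse \<open>inv p\<close> is written \<^term>\<open>inv_into UNIV p\<close>, as the notation \<open>inv\<close> clashes with
  that of HOL-Algebra.\<close>

definition A_property :: "('a::finite_field \<Rightarrow> 'a) \<Rightarrow> ('a \<Rightarrow> 'a) \<Rightarrow> ('a \<Rightarrow> 'a) \<Rightarrow> bool" where
  "A_property p1 p2 p3 \<longleftrightarrow>
     (let p4 = (\<lambda>y. p1 y + p2 y + p3 y) in
        bij p4 \<and>
        inv_into UNIV p4 = (\<lambda>x. inv_into UNIV p1 x + inv_into UNIV p2 x + inv_into UNIV p3 x))"

definition walsh :: "nat \<Rightarrow> (bit vec \<Rightarrow> bit) \<Rightarrow> bit vec \<Rightarrow> int" where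
  "walsh N g a = (\<Sum>z\<in>carrier_vec N. (- 1) ^ of_bit (g z + a \<bullet> z))"

definition bent :: "nat \<Rightarrow> (bit vec \<Rightarrow> bit) \<Rightarrow> bool" where
  "bent N g \<longleftrightarrow> even N \<and>
     (\<forall>a\<in>carrier_vec N. walsh N g a = 2 ^ (N div 2) \<or> walsh N g a = - (2 ^ (N div 2)))"

text \<open>Coordinates are numbered from \<open>0\<close>, so the two new variables have the indices \<open>n\<close> and \<open>n + 1\<close>.\<close>

definition concat4 ::
    "nat \<Rightarrow> (bit vec \<Rightarrow> bit) \<Rightarrow> (bit vec \<Rightarrow> bit) \<Rightarrow> (bit vec \<Rightarrow> bit) \<Rightarrow> (bit vec \<Rightarrow> bit) \<Rightarrow> bit vec \<Rightarrow> bit"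
  where
  "concat4 n g1 g2 g3 g4 w =
     (let z = vec_first w n; u = w $ n; v = w $ (n + 1) in
        g1 z + u * (g1 z + g3 z) + v * (g1 z + g2 z) + u * v * (g1 z + g2 z + g3 z + g4 z))"

text \<open>
  An identification of the coordinate space with the plane over the field of \<open>2 ^ m\<close> elements is a
  bijection that is linear over the field with two elements; for such vector spaces linear is the
  same as additive.
\<close>

definition identification :: "nat \<Rightarrow> (bit vec \<Rightarrow> 'a::finite_field \<times> 'a) \<Rightarrow> bool" where
  "identification n \<phi> \<longleftrightarrow>
     bij_betw \<phi> (carrier_vec n) UNIV \<and>
     (\<forall>z\<in>carrier_vec n. \<forall>w\<in>carrier_vec n. \<phi> (z + w) = \<phi> z + \<phi> w)"

lemma carrier_vec_bit:
  "finite (carrier_vec n :: bit vec set) \<and> card (carrier_vec n :: bit vec set) = 2 ^ n"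
proof -
  have U: "(UNIV :: bit set) = {0, 1}"
    using bit.exhaust by blast
  have "(carrier_vec n :: bit vec set) = vec_of_list ` {xs. set xs \<subseteq> UNIV \<and> length xs = n}"
  proof (intro equalityI subsetI)
    fix z :: "bit vec"
    assume "z \<in> carrier_vec n"
    then have "z = vec_of_list (list_of_vec z)" "length (list_of_vec z) = n"
      by (simp_all add: vec_list)
    then show "z \<in> vec_of_list ` {xs. set xs \<subseteq> UNIV \<and> length xs = n}"
      by blast
  next
    fix z :: "bit vec"
    assume "z \<in> vec_of_list ` {xs. set xs \<subseteq> UNIV \<and> length xs = n}"
    then obtain xs where "z = vec_of_list xs" "length xs = n"
      by blast
    then show "z \<in> carrier_vec n"
      by (intro carrier_vecI) (simp add: dim_vec_of_list)
  qed
  moreover have "inj_on vec_of_list {xs :: bit list. set xs \<subseteq> UNIV \<and> length xs = n}"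
    by (rule inj_on_inverseI[where g = list_of_vec]) (rule list_vec)
  moreover have "finite (UNIV :: bit set)" and "CARD(bit) = 2"
    by (simp_all add: U)
  ultimately show ?thesis
    using finite_lists_length_eq[of "UNIV :: bit set" n] card_lists_length_eq[of "UNIV :: bit set" n]
    by (simp only: card_image finite_imageI simp_thms)
qed

lemma identification_exists:
  assumes "CARD('a::finite_field) = 2 ^ m"
  shows "\<exists>\<phi> :: bit vec \<Rightarrow> 'a \<times> 'a. identification (2 * m) \<phi>"
proof -
  have dbl: "p + p = 0" for p :: "'a \<times> 'a"
  proof -
    have "of_nat 2 = (0 :: 'a)"
      using CHAR_eq_2[OF assms] by (metis of_nat_CHAR)
    then have "a + a = 0" for a :: 'a
      by (metis mult_2 mult_zero_left of_nat_numeral)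
    then show ?thesis
      by (cases p) (simp add: zero_prod_def)
  qed
  have cardP: "CARD('a \<times> 'a) = 2 ^ (2 * m)"
    using assms by (simp add: power_mult power2_eq_square flip: power_add mult_2)
  have "k \<le> 2 * m \<Longrightarrow> \<exists>\<phi> :: bit vec \<Rightarrow> 'a \<times> 'a. inj_on \<phi> (carrier_vec k) \<and>
          (\<forall>z\<in>carrier_vec k. \<forall>w\<in>carrier_vec k. \<phi> (z + w) = \<phi> z + \<phi> w)" for k
  proof (induction k)
    case 0
    have "inj_on (\<lambda>_. 0 :: 'a \<times> 'a) (carrier_vec 0 :: bit vec set)"
      by (auto intro!: inj_onI)
    then show ?case
      by (intro exI[of _ "\<lambda>_. 0"]) auto
  next
    case (Suc k)
    then obtain \<phi> :: "bit vec \<Rightarrow> 'a \<times> 'a" where inj: "inj_on \<phi> (carrier_vec k)"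
      and add: "\<And>z w. z \<in> carrier_vec k \<Longrightarrow> w \<in> carrier_vec k \<Longrightarrow> \<phi> (z + w) = \<phi> z + \<phi> w"
      by auto
    have "card (\<phi> ` carrier_vec k) < CARD('a \<times> 'a)"
      using Suc.prems inj unfolding cardP by (simp add: card_image carrier_vec_bit)
    then obtain p where p: "p \<notin> \<phi> ` carrier_vec k"
      by (metis UNIV_eq_I less_irrefl)
    define \<psi> where "\<psi> z = \<phi> (vec_first z k) + (if z $ k = 0 then 0 else p)" for z
    have first_add: "vec_first (z + w) k = vec_first z k + vec_first w k"
      if "z \<in> carrier_vec (Suc k)" "w \<in> carrier_vec (Suc k)" for z w :: "bit vec"
      using that by (auto simp: vec_first_def)
    have "\<psi> (z + w) = \<psi> z + \<psi> w"
      if "z \<in> carrier_vec (Suc k)" "w \<in> carrier_vec (Suc k)" for z w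
    proof -
      have "(z + w) $ k = z $ k + w $ k"
        using that by auto
      then show ?thesis
        using that dbl[of p] unfolding \<psi>_def
        by (cases "z $ k"; cases "w $ k") (simp_all add: first_add add ac_simps)
    qed
    moreover have "inj_on \<psi> (carrier_vec (Suc k))"
    proof (rule inj_onI)
      fix z w :: "bit vec"
      assume z: "z \<in> carrier_vec (Suc k)" and w: "w \<in> carrier_vec (Suc k)" and eq: "\<psi> z = \<psi> w"
      let ?z = "vec_first z k" and ?w = "vec_first w k"
      have p_img: "p = \<phi> (?z + ?w)" if "\<phi> ?z + p = \<phi> ?w \<or> \<phi> ?z = \<phi> ?w + p"
      proof -
        have "p = \<phi> ?z + \<phi> ?w"
          using that
        proof
          assume "\<phi> ?z + p = \<phi> ?w"
          then have "\<phi> ?z + \<phi> ?w = (\<phi> ?z + \<phi> ?z) + p"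
            by (simp only: add.assoc)
          then show ?thesis
            by (simp add: dbl)
        next
          assume "\<phi> ?z = \<phi> ?w + p"
          then have "\<phi> ?z + \<phi> ?w = (\<phi> ?w + \<phi> ?w) + p"
            by (simp only: ac_simps)
          then show ?thesis
            by (simp add: dbl)
        qed
        then show ?thesis
          by (simp add: add)
      qed
      have mem: "?z + ?w \<in> carrier_vec k"
        by simp
      have last: "z $ k = w $ k"
        using eq p_img p mem unfolding \<psi>_def by (cases "z $ k"; cases "w $ k") auto
      then have "\<phi> ?z = \<phi> ?w"
        using eq unfolding \<psi>_def by simp
      then have "?z = ?w"
        using inj by (auto dest: inj_onD)
      then have "z $ i = w $ i" if "i < k" for i
        using that by (metis index_vec vec_first_def)
      then show "z = w"
        using z w last by (auto intro!: eq_vecI simp: less_Suc_eq)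
    qed
    ultimately show ?case
      by blast
  qed
  from this[of "2 * m"] obtain \<phi> :: "bit vec \<Rightarrow> 'a \<times> 'a" where inj: "inj_on \<phi> (carrier_vec (2 * m))"
    and add: "\<forall>z\<in>carrier_vec (2 * m). \<forall>w\<in>carrier_vec (2 * m). \<phi> (z + w) = \<phi> z + \<phi> w"
    by auto
  have "\<phi> ` carrier_vec (2 * m) = UNIV"
    by (rule card_subset_eq) (use inj in \<open>simp_all only: card_image carrier_vec_bit cardP finite subset_UNIV\<close>)
  with inj add show ?thesis
    unfolding identification_def bij_betw_def by blast
qed

end

theory Submission
  imports Defs "HOL-Computational_Algebra.Polynomial"
begin

text \<open>
  Write the linear functional \<open>z \<mapsto> a \<bullet> z\<close> on the plane as \<open>Tr (\<alpha> x) + L y\<close>. Summing over \<open>x\<close> first,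
  the transform of the Maiorana--McFarland function \<open>f\<^sub>i\<close> at \<open>a\<close> is \<open>2\<^sup>m\<close> times the sign of
  \<open>h\<^sub>i (y\<^sub>i) + L y\<^sub>i\<close>, where \<open>y\<^sub>i\<close> is the preimage of \<open>\<alpha>\<close> under \<open>\<pi>\<^sub>i\<close>. The four \<open>y\<^sub>i\<close> sum to \<open>0\<close>, so
  the \<open>L\<close>-parts cancel in the product of the four signs, which is \<open>-1\<close> by the condition on the
  \<open>h\<^sub>i\<close>. The transform of the concatenation is a sum of these four values with twists whose product
  is \<open>1\<close>, and four signs with product \<open>-1\<close> sum to \<open>2\<close> or \<open>-2\<close>.
\<close>

text \<open>These rules turn sums and products of bits into \<open>of_bool\<close> of propositional formulas.\<close>

declare add_bit_eq_xor [simp del] mult_bit_eq_and [simp del]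

section \<open>Signs of bits and character sums\<close>

lemma bit_add_eq_0_iff: "a + b = 0 \<longleftrightarrow> a = b" for a b :: bit
  by (cases a; cases b) simp_all

definition sign_bit :: "bit \<Rightarrow> int" where
  "sign_bit b = (- 1) ^ of_bit b"

lemma sign_bit_simps [simp]:
  "sign_bit 0 = 1" "sign_bit 1 = - 1"
  by (simp_all add: sign_bit_def)

lemma sign_bit_add: "sign_bit (a + b) = sign_bit a * sign_bit b"
  by (cases a; cases b) simp_all

lemma walsh_sign_bit: "walsh N g a = (\<Sum>z\<in>carrier_vec N. sign_bit (g z + a \<bullet> z))"
  unfolding walsh_def sign_bit_def ..

lemma sum_UNIV_bit: "(\<Sum>b\<in>UNIV. f b) = f (0 :: bit) + f 1"
proof -
  have "(UNIV :: bit set) = {0, 1}"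
    using bit.exhaust by blast
  show ?thesis
    unfolding \<open>UNIV = {0, 1}\<close> by simp
qed

lemma sum_four_signs:
  assumes "b1 + b2 + b3 + b4 = (1 :: bit)"
  shows "sign_bit b1 + sign_bit b2 + sign_bit b3 + sign_bit b4 = 2 \<or>
         sign_bit b1 + sign_bit b2 + sign_bit b3 + sign_bit b4 = - 2"
  using assms by (cases b1; cases b2; cases b3; cases b4) simp_all

lemma additive_zero:
  assumes "\<And>x y. L (x + y) = L x + (L y :: bit)"
  shows "L (0 :: 'a::monoid_add) = 0"
  using assms[of 0 0] by simp

text \<open>Translation by \<open>t\<close> permutes the group and flips every sign, so the sum
  equals its own negative.\<close>

lemma sum_sign_additive:
  fixes L :: "'a::{finite, group_add} \<Rightarrow> bit"
  assumes add: "\<And>x y. L (x + y) = L x + L y" and t: "L t \<noteq> 0"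
  shows "(\<Sum>x\<in>UNIV. sign_bit (L x)) = 0"
proof -
  have "(\<Sum>x\<in>UNIV. sign_bit (L x)) = (\<Sum>x\<in>UNIV. sign_bit (L (x + t)))"
    by (rule sum.reindex_bij_witness[of _ "\<lambda>x. x + t" "\<lambda>x. x - t"]) auto
  also have "\<dots> = - (\<Sum>x\<in>UNIV. sign_bit (L x))"
    using t by (cases "L t") (simp_all add: add sign_bit_add sum_negf)
  finally show ?thesis
    by simp
qed

section \<open>The trace: additivity, nontriviality, orthogonality and duality\<close>

lemma abs_trace_add:
  fixes x y :: "'a::finite_field"
  assumes "CARD('a) = 2 ^ m"
  shows "abs_trace m (x + y) = abs_trace m x + abs_trace m y"
proof -
  have char2: "CHAR('a) = 2"
    by (rule CHAR_eq_2[OF assms])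
  have two: "(1 :: 'a) + 1 = 0"
    by (metis char2 of_nat_CHAR of_nat_numeral one_add_one)
  have pow: "(x + y) ^ (2 ^ i) = x ^ (2 ^ i) + y ^ (2 ^ i)" for i
    using freshmans_dream'[where 'a='a] char2 two_is_prime_nat by metis
  have of_bit_add: "(of_bit (b + c) :: 'a) = of_bit b + of_bit c" for b c
    using two by (cases b; cases c) simp_all
  have "(of_bit (abs_trace m (x + y)) :: 'a) = of_bit (abs_trace m x + abs_trace m y)"
    unfolding of_bit_add of_bit_abs_trace[OF assms] by (simp add: pow sum.distrib)
  \<comment> \<open>\<open>of_bit b\<close> abbreviates \<open>of_bool (odd b)\<close>, so equality
    in the field comes down to parity.\<close>
  then have "odd (abs_trace m (x + y)) = odd (abs_trace m x + abs_trace m y)"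
    by (simp only: of_bool_eq_iff)
  then show ?thesis
    by (cases "abs_trace m (x + y)"; cases "abs_trace m x + abs_trace m y") simp_all
qed

text \<open>The trace is a polynomial function of degree less than the number of field elements.\<close>

lemma abs_trace_nonzero:
  assumes card: "CARD('a::finite_field) = 2 ^ m"
  shows "\<exists>x :: 'a. abs_trace m x \<noteq> 0"
proof (rule ccontr)
  assume "\<not> ?thesis"
  then have zero: "(\<Sum>i<m. x ^ (2 ^ i)) = 0" for x :: 'a
    using of_bit_abs_trace[OF card, of x] by simp
  define p :: "'a poly" where "p = (\<Sum>i<m. monom 1 (2 ^ i))"
  have "m > 0"
  proof (rule ccontr)
    assume "\<not> m > 0"
    then have "card {0, 1 :: 'a} \<le> 1"
      using card card_mono[of UNIV "{0, 1 :: 'a}"] by simp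
    then show False
      by simp
  qed
  \<comment> \<open>Only \<open>i = 0\<close> gives the exponent 1, and this term is present because
    \<open>m > 0\<close>.\<close>
  have "coeff p 1 = (\<Sum>i<m. if i = 0 then 1 else 0)"
    unfolding p_def coeff_sum by (intro sum.cong) auto
  then have "p \<noteq> 0"
    using \<open>m > 0\<close> by auto
  moreover have "degree p \<le> 2 ^ (m - 1)"
    unfolding p_def
    by (intro degree_sum_le) (auto intro!: order.trans[OF degree_monom_le] power_increasing)
  moreover have "{x. poly p x = 0} = UNIV"
    using zero by (simp add: p_def poly_sum poly_monom)
  ultimately have "(2 :: nat) ^ m \<le> 2 ^ (m - 1)"
    using card_poly_roots_bound[of p] card by (metis order.trans)
  then show False
    using \<open>m > 0\<close> by simp
qed

text \<open>Orthogonality of characters: multiplication by a nonzero \<open>c\<close> is onto, so it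
  hits a point of nonzero trace and the character is nontrivial.\<close>

lemma sum_sign_abs_trace:
  fixes c :: "'a::finite_field"
  assumes card: "CARD('a) = 2 ^ m"
  shows "(\<Sum>x\<in>UNIV. sign_bit (abs_trace m (x * c))) = (if c = 0 then 2 ^ m else 0)"
proof -
  have add: "abs_trace m ((x + y) * c) = abs_trace m (x * c) + abs_trace m (y * c)" for x y
    by (simp add: distrib_right abs_trace_add[OF card])
  show ?thesis
  proof (cases "c = 0")
    case True
    have "abs_trace m (0 :: 'a) = 0"
      by (rule additive_zero) (rule abs_trace_add[OF card])
    with True show ?thesis
      by (simp add: card)
  next
    case False
    obtain x :: 'a where "abs_trace m x \<noteq> 0"
      using abs_trace_nonzero[OF card] by blast
    then have "abs_trace m ((x / c) * c) \<noteq> 0"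
      using False by simp
    from sum_sign_additive[of "\<lambda>x. abs_trace m (x * c)", OF add this] False show ?thesis
      by simp
  qed
qed

text \<open>
  The Fourier coefficients of the sign of \<open>L\<close> against the trace characters sum to \<open>2\<^sup>m\<close>, so one of
  them does not vanish, which forces the two characters to agree.
\<close>

lemma additive_eq_abs_trace:
  fixes L :: "'a::finite_field \<Rightarrow> bit"
  assumes card: "CARD('a) = 2 ^ m" and add: "\<And>x y. L (x + y) = L x + L y"
  obtains \<alpha> where "\<And>x. L x = abs_trace m (x * \<alpha>)"
proof -
  have "(\<Sum>\<beta>\<in>UNIV. \<Sum>x\<in>UNIV. sign_bit (abs_trace m (x * \<beta>) + L x)) =
        (\<Sum>x\<in>UNIV. (\<Sum>\<beta>\<in>UNIV. sign_bit (abs_trace m (\<beta> * x))) * sign_bit (L x))"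
    by (subst sum.swap) (simp add: sign_bit_add sum_distrib_left mult.commute)
  \<comment> \<open>Orthogonality in \<open>\<beta>\<close> leaves only \<open>x = 0\<close>, where
    \<open>L\<close> vanishes.\<close>
  also have "\<dots> = (\<Sum>x\<in>UNIV. if x = 0 then 2 ^ m * sign_bit (L x) else 0)"
    by (intro sum.cong) (simp_all add: sum_sign_abs_trace[OF card])
  also have "\<dots> \<noteq> 0"
    by (simp add: additive_zero[of L, OF add])
  finally obtain \<beta> where \<beta>: "(\<Sum>x\<in>UNIV. sign_bit (abs_trace m (x * \<beta>) + L x)) \<noteq> 0"
    by (rule sum.not_neutral_contains_not_neutral)
  have M_add: "abs_trace m ((x + y) * \<beta>) + L (x + y) =
      (abs_trace m (x * \<beta>) + L x) + (abs_trace m (y * \<beta>) + L y)" for x y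
    unfolding distrib_right abs_trace_add[OF card] add by (simp only: ac_simps)
  \<comment> \<open>A nonzero value of this additive map anywhere would make the sum in
    \<open>\<beta>\<close> vanish.\<close>
  have "abs_trace m (x * \<beta>) + L x = 0" for x
    using sum_sign_additive[of "\<lambda>x. abs_trace m (x * \<beta>) + L x" x, OF M_add] \<beta> by blast
  then have "L x = abs_trace m (x * \<beta>)" for x
    unfolding bit_add_eq_0_iff by (rule sym)
  then show ?thesis
    by (rule that)
qed

section \<open>Walsh transforms on the plane and of a concatenation\<close>

lemma walsh_Maiorana_McFarland:
  fixes p :: "'a::finite_field \<Rightarrow> 'a" and h L :: "'a \<Rightarrow> bit"
  assumes card: "CARD('a) = 2 ^ m" and p: "bij p"
  shows "(\<Sum>(x, y)\<in>UNIV. sign_bit (abs_trace m (x * p y) + h y + (abs_trace m (x * \<alpha>) + L y))) =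
         2 ^ m * sign_bit (h (inv_into UNIV p \<alpha>) + L (inv_into UNIV p \<alpha>))"
proof -
  have double: "a + b = 0 \<longleftrightarrow> a = b" for a b :: 'a
  proof -
    have "b + b = 0"
      by (metis CHAR_eq_2[OF card] mult_2 mult_zero_left of_nat_CHAR of_nat_numeral)
    then show ?thesis
      by (metis add_right_cancel)
  qed
  have "(\<Sum>(x, y)\<in>UNIV. sign_bit (abs_trace m (x * p y) + h y + (abs_trace m (x * \<alpha>) + L y))) =
        (\<Sum>y\<in>UNIV. \<Sum>x\<in>UNIV. sign_bit (h y + L y) * sign_bit (abs_trace m (x * (p y + \<alpha>))))"
    by (subst sum.swap)
      (simp add: sum.cartesian_product distrib_left abs_trace_add[OF card] sign_bit_add ac_simps)
  \<comment> \<open>By orthogonality the sum over \<open>x\<close> survives only for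
    \<open>p y + \<alpha> = 0\<close>, which in characteristic 2 means
    \<open>p y = \<alpha>\<close>.\<close>
  also have "\<dots> = (\<Sum>y\<in>UNIV. if y = inv_into UNIV p \<alpha> then 2 ^ m * sign_bit (h y + L y) else 0)"
  proof (intro sum.cong refl)
    fix y
    have "p y + \<alpha> = 0 \<longleftrightarrow> y = inv_into UNIV p \<alpha>"
      using double p by (metis bij_inv_eq_iff)
    then show "(\<Sum>x\<in>UNIV. sign_bit (h y + L y) * sign_bit (abs_trace m (x * (p y + \<alpha>)))) =
        (if y = inv_into UNIV p \<alpha> then 2 ^ m * sign_bit (h y + L y) else 0)"
      by (simp add: sum_sign_abs_trace[OF card] flip: sum_distrib_left)
  qed
  finally show ?thesis
    by simp
qed

text \<open>The dot product with \<open>a\<close>, pulled back along the inverse of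
  \<open>\<phi>\<close>, is additive on the plane and so splits over the two coordinates. The same
  \<open>L1\<close> and \<open>L2\<close> serve every \<open>f\<close>, hence all four functions at
  once.\<close>

lemma walsh_identification:
  assumes \<phi>: "identification n \<phi>" and a: "a \<in> carrier_vec n"
  obtains L1 L2 :: "'a::finite_field \<Rightarrow> bit"
  where "\<And>x y. L1 (x + y) = L1 x + L1 y" and "\<And>x y. L2 (x + y) = L2 x + L2 y"
    and "\<And>f. walsh n (f \<circ> \<phi>) a = (\<Sum>(x, y)\<in>UNIV. sign_bit (f (x, y) + (L1 x + L2 y)))"
proof -
  have bij: "bij_betw \<phi> (carrier_vec n) UNIV"
    and add: "\<And>z w. z \<in> carrier_vec n \<Longrightarrow> w \<in> carrier_vec n \<Longrightarrow> \<phi> (z + w) = \<phi> z + \<phi> w"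
    using \<phi> unfolding identification_def by blast+
  define \<psi> where "\<psi> = inv_into (carrier_vec n) \<phi>"
  have \<psi>: "\<psi> q \<in> carrier_vec n" "\<phi> (\<psi> q) = q" for q
    using bij unfolding \<psi>_def
    by (metis UNIV_I bij_betw_def inv_into_into) (metis UNIV_I bij bij_betw_inv_into_right)
  have \<psi>\<phi>: "\<psi> (\<phi> z) = z" if "z \<in> carrier_vec n" for z
    using that bij unfolding \<psi>_def by (metis bij_betw_inv_into_left)
  have \<psi>_add: "\<psi> (q + r) = \<psi> q + \<psi> r" for q r
    by (metis \<psi> \<psi>\<phi> add add_carrier_vec)
  define M where "M q = a \<bullet> \<psi> q" for q
  have M_add: "M (q + r) = M q + M r" for q r
    unfolding M_def \<psi>_add using a \<psi> by (simp add: scalar_prod_add_distrib)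
  have M_split: "M (x, y) = M (x, 0) + M (0, y)" for x y
    by (simp flip: M_add)
  have "walsh n (f \<circ> \<phi>) a = (\<Sum>(x, y)\<in>UNIV. sign_bit (f (x, y) + (M (x, 0) + M (0, y))))" for f
  proof -
    have "walsh n (f \<circ> \<phi>) a = (\<Sum>q\<in>UNIV. sign_bit (f q + M q))"
      unfolding walsh_sign_bit
      by (rule sum.reindex_bij_witness[of _ \<psi> \<phi>]) (simp_all add: \<psi> \<psi>\<phi> M_def)
    then show ?thesis
      unfolding M_split[symmetric] by (simp add: case_prod_beta)
  qed
  moreover have "M (x + y, 0) = M (x, 0) + M (y, 0)" "M (0, x + y) = M (0, x) + M (0, y)" for x y
    by (simp_all flip: M_add)
  ultimately show ?thesis
    using that[of "\<lambda>x. M (x, 0)" "\<lambda>y. M (0, y)"] by blast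
qed

text \<open>Fixing the last two bits cuts the space into four slices. On each of them the
  concatenation is one of the \<open>g\<close>s, and the two extra terms of the dot product are
  constant.\<close>

lemma walsh_concat4:
  assumes a: "a \<in> carrier_vec (n + 2)"
  shows "walsh (n + 2) (concat4 n g1 g2 g3 g4) a =
    walsh n g1 (vec_first a n) + sign_bit (a $ (n + 1)) * walsh n g2 (vec_first a n) +
    sign_bit (a $ n) * walsh n g3 (vec_first a n) +
    sign_bit (a $ n + a $ (n + 1)) * walsh n g4 (vec_first a n)"
proof -
  define ext :: "bit vec \<times> bit \<times> bit \<Rightarrow> bit vec" where
    "ext = (\<lambda>(z, u, v). vec (n + 2) (\<lambda>i. if i < n then z $ i else if i = n then u else v))"
  have first: "vec_first (ext (z, u, v)) n = z" if "z \<in> carrier_vec n" for z u v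
    using that by (auto simp: ext_def vec_first_def)
  have dot: "a \<bullet> ext (z, u, v) = vec_first a n \<bullet> z + a $ n * u + a $ (n + 1) * v"
    if "z \<in> carrier_vec n" for z u v
    using that by (simp add: scalar_prod_def ext_def vec_first_def)
  have "walsh (n + 2) (concat4 n g1 g2 g3 g4) a =
      (\<Sum>q\<in>carrier_vec n \<times> UNIV \<times> UNIV.
        sign_bit (concat4 n g1 g2 g3 g4 (ext q) + a \<bullet> ext q))"
    unfolding walsh_sign_bit
  proof (rule sum.reindex_bij_witness[of _ ext "\<lambda>w. (vec_first w n, w $ n, w $ (n + 1))"])
    fix w :: "bit vec"
    assume "w \<in> carrier_vec (n + 2)"
    then show "ext (vec_first w n, w $ n, w $ (n + 1)) = w"
      by (auto simp: ext_def vec_first_def less_Suc_eq)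
    then show "sign_bit (concat4 n g1 g2 g3 g4 (ext (vec_first w n, w $ n, w $ (n + 1))) +
        a \<bullet> ext (vec_first w n, w $ n, w $ (n + 1))) =
        sign_bit (concat4 n g1 g2 g3 g4 w + a \<bullet> w)"
      by simp
  qed (auto simp: first, auto simp: ext_def)
  also have "\<dots> = (\<Sum>z\<in>carrier_vec n. \<Sum>u\<in>UNIV. \<Sum>v\<in>UNIV.
      sign_bit (concat4 n g1 g2 g3 g4 (ext (z, u, v)) + a \<bullet> ext (z, u, v)))"
    by (simp add: sum.cartesian_product)
  also have "\<dots> = (\<Sum>z\<in>carrier_vec n.
      sign_bit (g1 z + vec_first a n \<bullet> z) +
      sign_bit (a $ (n + 1)) * sign_bit (g2 z + vec_first a n \<bullet> z) +
      sign_bit (a $ n) * sign_bit (g3 z + vec_first a n \<bullet> z) +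
      sign_bit (a $ n + a $ (n + 1)) * sign_bit (g4 z + vec_first a n \<bullet> z))"
  proof (intro sum.cong refl)
    fix z :: "bit vec"
    assume z: "z \<in> carrier_vec n"
    have ind: "ext (z, u, v) $ n = u" "ext (z, u, v) $ (n + 1) = v" for u v
      by (simp_all add: ext_def)
    have val: "concat4 n g1 g2 g3 g4 (ext (z, u, v)) =
        (if u = 0 then if v = 0 then g1 z else g2 z else if v = 0 then g3 z else g4 z)" for u v
      unfolding concat4_def Let_def first[OF z] ind
      by (cases u; cases v; cases "g1 z"; cases "g2 z"; cases "g3 z") simp_all
    show "(\<Sum>u\<in>UNIV. \<Sum>v\<in>UNIV.
        sign_bit (concat4 n g1 g2 g3 g4 (ext (z, u, v)) + a \<bullet> ext (z, u, v))) =
      sign_bit (g1 z + vec_first a n \<bullet> z) +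
      sign_bit (a $ (n + 1)) * sign_bit (g2 z + vec_first a n \<bullet> z) +
      sign_bit (a $ n) * sign_bit (g3 z + vec_first a n \<bullet> z) +
      sign_bit (a $ n + a $ (n + 1)) * sign_bit (g4 z + vec_first a n \<bullet> z)"
      unfolding sum_UNIV_bit val dot[OF z] by (simp add: sign_bit_add)
  qed
  finally show ?thesis
    by (simp add: walsh_sign_bit sum.distrib flip: sum_distrib_left)
qed

section \<open>Bentness of the concatenation\<close>

theorem theorem3:
  fixes m n :: nat
    and \<pi>1 \<pi>2 \<pi>3 :: "'a::finite_field \<Rightarrow> 'a"
    and h1 h2 h3 h4 s :: "'a \<Rightarrow> bit"
    and f1 f2 f3 f4 :: "'a \<times> 'a \<Rightarrow> bit"
    and \<phi> :: "bit vec \<Rightarrow> 'a \<times> 'a"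
  assumes "m \<ge> 1" and "n = 2 * m" and "CARD('a) = 2 ^ m"
    and "bij \<pi>1" and "bij \<pi>2" and "bij \<pi>3"
    and "A_property \<pi>1 \<pi>2 \<pi>3"
    and "\<And>x y. f1 (x, y) = abs_trace m (x * \<pi>1 y) + h1 y"
    and "\<And>x y. f2 (x, y) = abs_trace m (x * \<pi>2 y) + h2 y"
    and "\<And>x y. f3 (x, y) = abs_trace m (x * \<pi>3 y) + h3 y"
    and "\<And>y. h4 y = h1 y + h2 y + h3 y + s y"
    and "\<And>x y. f4 (x, y) = f1 (x, y) + f2 (x, y) + f3 (x, y) + s y"
    and "\<And>x. h1 (inv_into UNIV \<pi>1 x) + h2 (inv_into UNIV \<pi>2 x) + h3 (inv_into UNIV \<pi>3 x)
               + h4 (inv_into UNIV (\<lambda>y. \<pi>1 y + \<pi>2 y + \<pi>3 y) x) = 1"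
    and "identification n \<phi>"
  shows "bent (n + 2) (concat4 n (f1 \<circ> \<phi>) (f2 \<circ> \<phi>) (f3 \<circ> \<phi>) (f4 \<circ> \<phi>))"
proof -
  define \<pi>4 where "\<pi>4 = (\<lambda>y. \<pi>1 y + \<pi>2 y + \<pi>3 y)"
  have bij4: "bij \<pi>4"
    and inv4: "inv_into UNIV \<pi>4 x =
      inv_into UNIV \<pi>1 x + inv_into UNIV \<pi>2 x + inv_into UNIV \<pi>3 x" for x
    using assms(7) unfolding A_property_def Let_def \<pi>4_def by simp_all
  \<comment> \<open>Since \<open>h4\<close> absorbs \<open>s\<close>, the fourth function is of
    Maiorana-McFarland type as well, with permutation \<open>\<pi>4\<close>.\<close>
  have f4: "f4 (x, y) = abs_trace m (x * \<pi>4 y) + h4 y" for x y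
    unfolding assms(8-12) \<pi>4_def by (simp add: distrib_left abs_trace_add[OF assms(3)] ac_simps)
  show ?thesis
    unfolding bent_def
  proof (intro conjI ballI)
    show "even (n + 2)"
      using assms(2) by simp
    fix a :: "bit vec"
    assume a: "a \<in> carrier_vec (n + 2)"
    define b where "b = vec_first a n"
    have "b \<in> carrier_vec n"
      by (simp add: b_def)
    with assms(14) obtain L1 L2 :: "'a \<Rightarrow> bit"
      where L1: "\<And>x y. L1 (x + y) = L1 x + L1 y" and L2: "\<And>x y. L2 (x + y) = L2 x + L2 y"
        and walsh: "\<And>f. walsh n (f \<circ> \<phi>) b = (\<Sum>(x, y)\<in>UNIV. sign_bit (f (x, y) + (L1 x + L2 y)))"
      by (rule walsh_identification) blast
    obtain \<alpha> where \<alpha>: "\<And>x. L1 x = abs_trace m (x * \<alpha>)"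
      using additive_eq_abs_trace[OF assms(3), of L1] L1 by blast
    define c where "c p h = h (inv_into UNIV p \<alpha>) + L2 (inv_into UNIV p \<alpha>)" for p h
    have walsh_f: "walsh n (f \<circ> \<phi>) b = 2 ^ m * sign_bit (c p h)"
      if "bij p" "\<And>x y. f (x, y) = abs_trace m (x * p y) + h y" for f p h
      unfolding walsh \<alpha> that(2) c_def by (rule walsh_Maiorana_McFarland[OF assms(3) that(1)])
    let ?u = "a $ n" and ?v = "a $ (n + 1)"
    have "c \<pi>1 h1 + c \<pi>2 h2 + c \<pi>3 h3 + c \<pi>4 h4 = 1"
    proof -
      \<comment> \<open>This is where the formula for the inverse of \<open>\<pi>4\<close> enters:
        the four values of \<open>L2\<close> cancel in the sum of the \<open>c\<close>s.\<close>
      have "L2 (inv_into UNIV \<pi>4 \<alpha>) =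
          L2 (inv_into UNIV \<pi>1 \<alpha>) + L2 (inv_into UNIV \<pi>2 \<alpha>) + L2 (inv_into UNIV \<pi>3 \<alpha>)"
        by (simp add: inv4 L2)
      then have "c \<pi>1 h1 + c \<pi>2 h2 + c \<pi>3 h3 + c \<pi>4 h4 =
          h1 (inv_into UNIV \<pi>1 \<alpha>) + h2 (inv_into UNIV \<pi>2 \<alpha>) + h3 (inv_into UNIV \<pi>3 \<alpha>)
          + h4 (inv_into UNIV \<pi>4 \<alpha>)"
        unfolding c_def
        by (cases "L2 (inv_into UNIV \<pi>1 \<alpha>)"; cases "L2 (inv_into UNIV \<pi>2 \<alpha>)";
            cases "L2 (inv_into UNIV \<pi>3 \<alpha>)") (simp_all add: ac_simps)
      also have "\<dots> = 1"
        unfolding \<pi>4_def by (rule assms(13))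
      finally show ?thesis .
    qed
    \<comment> \<open>Each of \<open>?u\<close> and \<open>?v\<close> occurs twice, so the twists
      leave the sum of the bits unchanged.\<close>
    then have "c \<pi>1 h1 + (?v + c \<pi>2 h2) + (?u + c \<pi>3 h3) + (?u + ?v + c \<pi>4 h4) = 1"
      by (cases ?u; cases ?v) (simp_all add: ac_simps)
    note signs = sum_four_signs[OF this]
    have "walsh (n + 2) (concat4 n (f1 \<circ> \<phi>) (f2 \<circ> \<phi>) (f3 \<circ> \<phi>) (f4 \<circ> \<phi>)) a =
        2 ^ m * (sign_bit (c \<pi>1 h1) + sign_bit (?v + c \<pi>2 h2) + sign_bit (?u + c \<pi>3 h3) +
          sign_bit (?u + ?v + c \<pi>4 h4))"
      unfolding walsh_concat4[OF a] b_def[symmetric]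
        walsh_f[OF assms(4,8)] walsh_f[OF assms(5,9)] walsh_f[OF assms(6,10)] walsh_f[OF bij4 f4]
      by (simp add: sign_bit_add algebra_simps)
    \<comment> \<open>The factor 2 or -2 from the four signs raises \<open>2 ^ m\<close> to the
      required absolute value.\<close>
    moreover have "(n + 2) div 2 = Suc m"
      using assms(2) by simp
    ultimately show "walsh (n + 2) (concat4 n (f1 \<circ> \<phi>) (f2 \<circ> \<phi>) (f3 \<circ> \<phi>) (f4 \<circ> \<phi>)) a = 2 ^ ((n + 2) div 2) \<or>
        walsh (n + 2) (concat4 n (f1 \<circ> \<phi>) (f2 \<circ> \<phi>) (f3 \<circ> \<phi>) (f4 \<circ> \<phi>)) a = - (2 ^ ((n + 2) div 2))"
      using signs by auto
  qed
qed

end
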